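(* Let $(A,\cdot_A,\mathfrak B)$ be a quadratic perm algebra and $r\in A\otimes A$ such that its skew-symmetric part $\frac12(r-\sigma(r))$ is $(R,\mathrm{ad})$-invariant. Define a linear map $P:A\to A$ by $P(a)=T_r\mathfrak B^\sharp(a)$ for all $a\in A$. Then $r$ is a solution of the perm Yang-Baxter equation in $(A,\cdot_A)$ if and only if $P$ satisfies $$P(a)\cdot_A P(b)=P\big(P(a)\cdot_A b+a\cdot_A P(b)-a\cdot_A T_{r-\sigma(r)}\mathfrak B^\sharp(b)\big),\quad\forall a,b\in A.$$
   Context: Conventions: the base field $\mathbb K$ has characteristic zero; all vector spaces and algebras are finite-dimensional. For a bilinear operation $\cdot_A$ on $A$: $L(a)b=a\cdot_A b$, $R(a)b=b\cdot_A a$, $\mathrm{ad}(a)=L(a)-R(a)$. $\sigma(u\otimes v)=v\otimes u$. Perm algebra: a vector space $A$ with bilinear $\cdot_A$ such that $a\cdot_A(b\cdot_A c)=(a\cdot_A b)\cdot_A c=(b\cdot_A a)\cdot_A c$ for all $a,b,c\in A$. For $r=\sum_i a_i\otimes b_i\in A\otimes A$: $T_r:A^*\to A$, $T_r(a^* )=\sum_i\langle a^*,a_i\rangle b_i$. $r$ is a solution of the perm Yang-Baxter equation in $(A,\cdot_A)$ if $\sum_{i,j}\big(a_i\otimes b_i\cdot_A a_j\otimes b_j-a_i\otimes a_j\otimes b_i\cdot_A b_j+a_i\cdot_A a_j\otimes b_i\otimes b_j-a_j\cdot_A a_i\otimes b_i\otimes b_j\big)=0$. $s\in A\otimes A$ is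 $(R,\mathrm{ad})$-invariant if $(\mathrm{id}\otimes R(a)-\mathrm{ad}(a)\otimes\mathrm{id})(s)=0$ for all $a\in A$. A bilinear form $\mathfrak B$ on a perm algebra is invariant if $\mathfrak B(a\cdot_A b,c)=\mathfrak B(a,b\cdot_A c-c\cdot_A b)$ for all $a,b,c\in A$. A quadratic perm algebra $(A,\cdot_A,\mathfrak B)$ is a perm algebra with a nondegenerate skew-symmetric invariant bilinear form $\mathfrak B$. For nondegenerate $\mathfrak B$, $\mathfrak B^\sharp:A\to A^*$ is the isomorphism $\langle\mathfrak B^\sharp(a),b\rangle=\mathfrak B(a,b)$. *)

theory Defs
  imports "HOL-Library.Poly_Mapping" "HOL.Vector_Spaces"
begin

section \<open>Free vector spaces\<close>

text \<open>The free vector space on a type \<open>'x\<close> over the field \<open>'k\<close> is \<open>'x \<Rightarrow>\<^sub>0 'k\<close>.\<close>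

definition free_scale :: "'k::field \<Rightarrow> ('x \<Rightarrow>\<^sub>0 'k) \<Rightarrow> ('x \<Rightarrow>\<^sub>0 'k)"
  where "free_scale c p = Poly_Mapping.map ((*) c) p"

abbreviation gen :: "'x \<Rightarrow> ('x \<Rightarrow>\<^sub>0 'k::field)"
  where "gen x \<equiv> Poly_Mapping.single x 1"

lemma lookup_free_scale [simp]: "Poly_Mapping.lookup (free_scale c p) x = c * Poly_Mapping.lookup p x"
  unfolding free_scale_def by transfer (simp add: when_def)

global_interpretation free: vector_space "free_scale :: 'k::field \<Rightarrow> ('x \<Rightarrow>\<^sub>0 'k) \<Rightarrow> ('x \<Rightarrow>\<^sub>0 'k)"
  by unfold_locales
    (auto intro!: poly_mapping_eqI simp: Poly_Mapping.lookup_add algebra_simps)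

text \<open>Linear extension of a map on generators; \<open>scale\<close> is the scalar multiplication of the target.\<close>

definition lin_ext :: "('k::field \<Rightarrow> 'v \<Rightarrow> 'v::ab_group_add) \<Rightarrow> ('x \<Rightarrow> 'v) \<Rightarrow> ('x \<Rightarrow>\<^sub>0 'k) \<Rightarrow> 'v"
  where "lin_ext scale f p = (\<Sum>x\<in>Poly_Mapping.keys p. scale (Poly_Mapping.lookup p x) (f x))"

section \<open>Tensor powers\<close>

text \<open>
  The tensor square and cube of the vector space \<open>'a\<close> with scalar multiplication \<open>scale\<close> are the
  quotients of the free vector spaces on pairs and triples by the subspaces spanned by the
  multilinearity relations. Tensors are cosets of these subspaces.
\<close>

definition rel2 :: "('k::field \<Rightarrow> 'a \<Rightarrow> 'a::ab_group_add) \<Rightarrow> (('a \<times> 'a) \<Rightarrow>\<^sub>0 'k) set"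
  where "rel2 scale = free.span
    ({gen (a + a', b) - gen (a, b) - gen (a', b) | a a' b. True} \<union>
     {gen (a, b + b') - gen (a, b) - gen (a, b') | a b b'. True} \<union>
     {gen (scale c a, b) - free_scale c (gen (a, b)) | c a b. True} \<union>
     {gen (a, scale c b) - free_scale c (gen (a, b)) | c a b. True})"

definition rel3 :: "('k::field \<Rightarrow> 'a \<Rightarrow> 'a::ab_group_add) \<Rightarrow> (('a \<times> 'a \<times> 'a) \<Rightarrow>\<^sub>0 'k) set"
  where "rel3 scale = free.span
    ({gen (a + a', b, c) - gen (a, b, c) - gen (a', b, c) | a a' b c. True} \<union>
     {gen (a, b + b', c) - gen (a, b, c) - gen (a, b', c) | a b b' c. True} \<union>
     {gen (a, b, c + c') - gen (a, b, c) - gen (a, b, c') | a b c c'. True} \<union>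
     {gen (scale k a, b, c) - free_scale k (gen (a, b, c)) | k a b c. True} \<union>
     {gen (a, scale k b, c) - free_scale k (gen (a, b, c)) | k a b c. True} \<union>
     {gen (a, b, scale k c) - free_scale k (gen (a, b, c)) | k a b c. True})"

definition coset :: "'v::ab_group_add set \<Rightarrow> 'v \<Rightarrow> 'v set"
  where "coset N p = {q. q - p \<in> N}"

definition tensor2 :: "('k::field \<Rightarrow> 'a \<Rightarrow> 'a::ab_group_add) \<Rightarrow> (('a \<times> 'a) \<Rightarrow>\<^sub>0 'k) set set"
  where "tensor2 scale = range (coset (rel2 scale))"

text \<open>
  The operations below are computed on a representative; the lemmas \<open>tdiff_coset\<close>, \<open>tscale_coset\<close>,
  \<open>tflip_coset\<close>, \<open>tmap_coset\<close>, \<open>T_coset\<close> and \<open>perm_YBE_coset\<close> state that its choice is irrelevant.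
\<close>

definition rep :: "'v set \<Rightarrow> 'v"
  where "rep r = (SOME p. p \<in> r)"

definition tdiff :: "('k::field \<Rightarrow> 'a \<Rightarrow> 'a::ab_group_add)
    \<Rightarrow> (('a \<times> 'a) \<Rightarrow>\<^sub>0 'k) set \<Rightarrow> (('a \<times> 'a) \<Rightarrow>\<^sub>0 'k) set \<Rightarrow> (('a \<times> 'a) \<Rightarrow>\<^sub>0 'k) set"
  where "tdiff scale r s = coset (rel2 scale) (rep r - rep s)"

definition tscale :: "('k::field \<Rightarrow> 'a \<Rightarrow> 'a::ab_group_add)
    \<Rightarrow> 'k \<Rightarrow> (('a \<times> 'a) \<Rightarrow>\<^sub>0 'k) set \<Rightarrow> (('a \<times> 'a) \<Rightarrow>\<^sub>0 'k) set"
  where "tscale scale c r = coset (rel2 scale) (free_scale c (rep r))"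

text \<open>\<open>tflip\<close> is \<open>\<sigma>\<close>, and \<open>tmap scale f g\<close> is \<open>f \<otimes> g\<close> for linear \<open>f\<close> and \<open>g\<close>.\<close>

definition tflip :: "('k::field \<Rightarrow> 'a \<Rightarrow> 'a::ab_group_add)
    \<Rightarrow> (('a \<times> 'a) \<Rightarrow>\<^sub>0 'k) set \<Rightarrow> (('a \<times> 'a) \<Rightarrow>\<^sub>0 'k) set"
  where "tflip scale r = coset (rel2 scale) (lin_ext free_scale (\<lambda>(a, b). gen (b, a)) (rep r))"

definition tmap :: "('k::field \<Rightarrow> 'a \<Rightarrow> 'a::ab_group_add) \<Rightarrow> ('a \<Rightarrow> 'a) \<Rightarrow> ('a \<Rightarrow> 'a)
    \<Rightarrow> (('a \<times> 'a) \<Rightarrow>\<^sub>0 'k) set \<Rightarrow> (('a \<times> 'a) \<Rightarrow>\<^sub>0 'k) set"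
  where "tmap scale f g r = coset (rel2 scale) (lin_ext free_scale (\<lambda>(a, b). gen (f a, g b)) (rep r))"

definition skew_part :: "('k::field \<Rightarrow> 'a \<Rightarrow> 'a::ab_group_add)
    \<Rightarrow> (('a \<times> 'a) \<Rightarrow>\<^sub>0 'k) set \<Rightarrow> (('a \<times> 'a) \<Rightarrow>\<^sub>0 'k) set"
  where "skew_part scale r = tscale scale (1 / 2) (tdiff scale r (tflip scale r))"

text \<open>\<open>T scale r f = (\<Sum>i. f a\<^sub>i *s b\<^sub>i)\<close> for \<open>r = (\<Sum>i. a\<^sub>i \<otimes> b\<^sub>i)\<close> and a linear functional \<open>f\<close>.\<close>

definition T :: "('k::field \<Rightarrow> 'a \<Rightarrow> 'a::ab_group_add) \<Rightarrow> (('a \<times> 'a) \<Rightarrow>\<^sub>0 'k) set \<Rightarrow> ('a \<Rightarrow> 'k) \<Rightarrow> 'a"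
  where "T scale r f = lin_ext scale (\<lambda>(a, b). scale (f a) b) (rep r)"

section \<open>Perm algebras\<close>

text \<open>
  \<open>Basis\<close> is an arbitrary finite basis that only witnesses finite-dimensionality.
\<close>

locale perm_algebra = finite_dimensional_vector_space scale Basis
  for scale :: "'k::field_char_0 \<Rightarrow> 'a::ab_group_add \<Rightarrow> 'a" and Basis :: "'a set" +
  fixes mult :: "'a \<Rightarrow> 'a \<Rightarrow> 'a"
  assumes linear_mult_right: "\<And>a. Vector_Spaces.linear scale scale (\<lambda>b. mult a b)"
    and linear_mult_left: "\<And>b. Vector_Spaces.linear scale scale (\<lambda>a. mult a b)"
    and perm_assoc: "\<And>a b c. mult a (mult b c) = mult (mult a b) c"
    and perm_left_comm: "\<And>a b c. mult (mult a b) c = mult (mult b a) c"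

locale quadratic_perm_algebra = perm_algebra scale Basis mult
  for scale :: "'k::field_char_0 \<Rightarrow> 'a::ab_group_add \<Rightarrow> 'a" and Basis :: "'a set"
    and mult :: "'a \<Rightarrow> 'a \<Rightarrow> 'a" +
  fixes B :: "'a \<Rightarrow> 'a \<Rightarrow> 'k"
  assumes linear_form_right: "\<And>a. Vector_Spaces.linear scale (*) (\<lambda>b. B a b)"
    and linear_form_left: "\<And>b. Vector_Spaces.linear scale (*) (\<lambda>a. B a b)"
    and nondegenerate_left: "\<And>a. (\<And>b. B a b = 0) \<Longrightarrow> a = 0"
    and nondegenerate_right: "\<And>b. (\<And>a. B a b = 0) \<Longrightarrow> b = 0"
    and skew_symmetric: "\<And>a b. B a b = - B b a"
    and invariant: "\<And>a b c. B (mult a b) c = B a (mult b c - mult c b)"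

definition right_mult :: "('a \<Rightarrow> 'a \<Rightarrow> 'a) \<Rightarrow> 'a \<Rightarrow> 'a \<Rightarrow> 'a"
  where "right_mult mult a b = mult b a"

definition ad :: "('a \<Rightarrow> 'a \<Rightarrow> 'a::ab_group_add) \<Rightarrow> 'a \<Rightarrow> 'a \<Rightarrow> 'a"
  where "ad mult a b = mult a b - right_mult mult a b"

definition R_ad_invariant :: "('k::field \<Rightarrow> 'a \<Rightarrow> 'a::ab_group_add) \<Rightarrow> ('a \<Rightarrow> 'a \<Rightarrow> 'a)
    \<Rightarrow> (('a \<times> 'a) \<Rightarrow>\<^sub>0 'k) set \<Rightarrow> bool"
  where "R_ad_invariant scale mult s \<longleftrightarrow>
    (\<forall>a. tdiff scale (tmap scale id (right_mult mult a) s) (tmap scale (ad mult a) id s)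
       = coset (rel2 scale) 0)"

definition sharp :: "('a \<Rightarrow> 'a \<Rightarrow> 'k) \<Rightarrow> 'a \<Rightarrow> ('a \<Rightarrow> 'k)"
  where "sharp B a = (\<lambda>b. B a b)"

text \<open>The double sum of the perm Yang-Baxter equation, bilinearly extended to formal sums of pairs.\<close>

definition ybe_sum :: "('a \<Rightarrow> 'a \<Rightarrow> 'a) \<Rightarrow> (('a \<times> 'a) \<Rightarrow>\<^sub>0 'k::field) \<Rightarrow> (('a \<times> 'a) \<Rightarrow>\<^sub>0 'k)
    \<Rightarrow> (('a \<times> 'a \<times> 'a) \<Rightarrow>\<^sub>0 'k)"
  where "ybe_sum mult p q =
    lin_ext free_scale (\<lambda>(a, b). lin_ext free_scale (\<lambda>(a', b').
      gen (a, mult b a', b') - gen (a, a', mult b b')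
      + gen (mult a a', b, b') - gen (mult a' a, b, b')) q) p"

definition perm_YBE :: "('k::field \<Rightarrow> 'a \<Rightarrow> 'a::ab_group_add) \<Rightarrow> ('a \<Rightarrow> 'a \<Rightarrow> 'a)
    \<Rightarrow> (('a \<times> 'a) \<Rightarrow>\<^sub>0 'k) set \<Rightarrow> bool"
  where "perm_YBE scale mult r \<longleftrightarrow>
    coset (rel3 scale) (ybe_sum mult (rep r) (rep r)) = coset (rel3 scale) 0"

section \<open>Independence of representatives\<close>

lemma subspace_rel2: "free.subspace (rel2 scale)"
  and subspace_rel3: "free.subspace (rel3 scale)"
  unfolding rel2_def rel3_def by simp_all

lemma coset_eq_iff:
  assumes "free.subspace N"
  shows "coset N p = coset N q \<longleftrightarrow> p - q \<in> N"
proof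
  assume "coset N p = coset N q"
  moreover have "p \<in> coset N p" using free.subspace_0[OF assms] by (simp add: coset_def)
  ultimately show "p - q \<in> N" by (simp add: coset_def)
next
  assume *: "p - q \<in> N"
  have "x - p \<in> N \<longleftrightarrow> x - q \<in> N" for x
    using free.subspace_add[OF assms _ *, of "x - p"] free.subspace_diff[OF assms _ *, of "x - q"]
    by (auto simp: algebra_simps)
  then show "coset N p = coset N q" by (simp add: coset_def)
qed

lemma rep_coset:
  assumes "free.subspace N"
  shows "rep (coset N p) - p \<in> N"
proof -
  have "p \<in> coset N p" using free.subspace_0[OF assms] by (simp add: coset_def)
  then have "rep (coset N p) \<in> coset N p" unfolding rep_def by (rule someI)
  then show ?thesis by (simp add: coset_def)
qed

lemma (in vector_space) lin_ext_superset:
  assumes "finite S" "Poly_Mapping.keys p \<subseteq> S"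
  shows "lin_ext scale f p = (\<Sum>x\<in>S. scale (Poly_Mapping.lookup p x) (f x))"
  unfolding lin_ext_def
  by (rule sum.mono_neutral_left) (use assms in \<open>auto simp: in_keys_iff\<close>)

lemma (in vector_space) lin_ext_add: "lin_ext scale f (p + q) = lin_ext scale f p + lin_ext scale f q"
proof -
  let ?S = "Poly_Mapping.keys p \<union> Poly_Mapping.keys q"
  have "lin_ext scale f x = (\<Sum>y\<in>?S. scale (Poly_Mapping.lookup x y) (f y))" if "x \<in> {p, q, p + q}" for x
    by (rule lin_ext_superset) (use that Poly_Mapping.keys_add[of p q] in auto)
  then show ?thesis by (simp add: Poly_Mapping.lookup_add scale_left_distrib sum.distrib)
qed

lemma (in vector_space) lin_ext_scale: "lin_ext scale f (free_scale c p) = scale c (lin_ext scale f p)"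
proof -
  have "Poly_Mapping.keys (free_scale c p) \<subseteq> Poly_Mapping.keys p" by (auto simp: in_keys_iff)
  then have "lin_ext scale f (free_scale c p)
      = (\<Sum>x\<in>Poly_Mapping.keys p. scale (Poly_Mapping.lookup (free_scale c p) x) (f x))"
    by (intro lin_ext_superset) auto
  then show ?thesis by (simp add: lin_ext_def scale_sum_right)
qed

lemma (in vector_space) lin_ext_diff: "lin_ext scale f (p - q) = lin_ext scale f p - lin_ext scale f q"
  using lin_ext_add[of f "p - q" q] by simp

lemma (in vector_space) lin_ext_gen: "lin_ext scale f (gen x) = f x"
  by (simp add: lin_ext_def)

lemma (in vector_space) lin_ext_0: "lin_ext scale f 0 = 0"
  by (simp add: lin_ext_def)

lemma (in vector_space) lin_ext_sum: "lin_ext scale f (\<Sum>i\<in>I. p i) = (\<Sum>i\<in>I. lin_ext scale f (p i))"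
  by (induction I rule: infinite_finite_induct) (simp_all add: lin_ext_add lin_ext_0)

lemma (in vector_space) lin_ext_mem:
  assumes "subspace N" "\<And>x. f x \<in> N"
  shows "lin_ext scale f p \<in> N"
  unfolding lin_ext_def using assms by (intro subspace_sum subspace_scale)

text \<open>A map on pairs that is bilinear modulo a subspace \<open>N\<close> maps \<open>rel2\<close> into \<open>N\<close>.\<close>

lemma (in vector_space) lin_ext_rel2:
  fixes s :: "'a \<Rightarrow> 'c \<Rightarrow> 'c::ab_group_add"
  assumes N: "subspace N"
    and "\<And>a a' b. f (a + a', b) - f (a, b) - f (a', b) \<in> N"
    and "\<And>a b b'. f (a, b + b') - f (a, b) - f (a, b') \<in> N"
    and "\<And>c a b. f (s c a, b) - scale c (f (a, b)) \<in> N"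
    and "\<And>c a b. f (a, s c b) - scale c (f (a, b)) \<in> N"
    and p: "p \<in> rel2 s"
  shows "lin_ext scale f p \<in> N"
  using p unfolding rel2_def
proof (induction rule: free.span_induct)
  case base
  show ?case using N
    by (auto simp: free.subspace_def subspace_def lin_ext_add lin_ext_scale lin_ext_0)
next
  case (step x)
  then show ?case using assms by (auto simp: lin_ext_diff lin_ext_scale lin_ext_gen)
qed

lemmas free_lin_ext_rel2 = free.lin_ext_rel2[OF subspace_rel2]

lemma rel2I:
  "gen (a + a', b) - gen (a, b) - gen (a', b) \<in> rel2 scale"
  "gen (a, b + b') - gen (a, b) - gen (a, b') \<in> rel2 scale"
  "gen (scale c a, b) - free_scale c (gen (a, b)) \<in> rel2 scale"
  "gen (a, scale c b) - free_scale c (gen (a, b)) \<in> rel2 scale"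
  unfolding rel2_def by (intro free.span_base; simp; blast)+

lemma rel3I:
  "gen (a + a', b, c) - gen (a, b, c) - gen (a', b, c) \<in> rel3 scale"
  "gen (a, b + b', c) - gen (a, b, c) - gen (a, b', c) \<in> rel3 scale"
  "gen (a, b, c + c') - gen (a, b, c) - gen (a, b, c') \<in> rel3 scale"
  "gen (scale k a, b, c) - free_scale k (gen (a, b, c)) \<in> rel3 scale"
  "gen (a, scale k b, c) - free_scale k (gen (a, b, c)) \<in> rel3 scale"
  "gen (a, b, scale k c) - free_scale k (gen (a, b, c)) \<in> rel3 scale"
  unfolding rel3_def by (rule free.span_base, simp only: Un_iff mem_Collect_eq, metis)+

lemma tdiff_coset: "tdiff scale (coset (rel2 scale) p) (coset (rel2 scale) q) = coset (rel2 scale) (p - q)"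
  unfolding tdiff_def coset_eq_iff[OF subspace_rel2]
  using free.subspace_diff[OF subspace_rel2
      rep_coset[OF subspace_rel2, of scale p] rep_coset[OF subspace_rel2, of scale q]]
  by (simp add: algebra_simps)

lemma tscale_coset: "tscale scale c (coset (rel2 scale) p) = coset (rel2 scale) (free_scale c p)"
  unfolding tscale_def coset_eq_iff[OF subspace_rel2]
  using free.subspace_scale[OF subspace_rel2 rep_coset[OF subspace_rel2, of scale p]]
  by (simp add: free.scale_right_diff_distrib)

lemma tflip_coset:
  "tflip scale (coset (rel2 scale) (\<Sum>i\<in>I. gen (a i, b i))) = coset (rel2 scale) (\<Sum>i\<in>I. gen (b i, a i))"
  unfolding tflip_def coset_eq_iff[OF subspace_rel2]
  using free_lin_ext_rel2[OF _ _ _ _ rep_coset[OF subspace_rel2[of scale], of "\<Sum>i\<in>I. gen (a i, b i)"],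
      of "\<lambda>(a, b). gen (b, a)" scale]
  by (simp add: free.lin_ext_diff free.lin_ext_sum free.lin_ext_gen rel2I)

lemma tmap_coset:
  assumes "Vector_Spaces.linear scale scale f" "Vector_Spaces.linear scale scale g"
  shows "tmap scale f g (coset (rel2 scale) (\<Sum>i\<in>I. gen (a i, b i)))
    = coset (rel2 scale) (\<Sum>i\<in>I. gen (f (a i), g (b i)))"
proof -
  interpret f: Vector_Spaces.linear scale scale f by fact
  interpret g: Vector_Spaces.linear scale scale g by fact
  show ?thesis unfolding tmap_def coset_eq_iff[OF subspace_rel2]
    using free_lin_ext_rel2[OF _ _ _ _ rep_coset[OF subspace_rel2[of scale], of "\<Sum>i\<in>I. gen (a i, b i)"],
        of "\<lambda>(a, b). gen (f a, g b)" scale]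
    by (simp add: free.lin_ext_diff free.lin_ext_sum free.lin_ext_gen rel2I
        f.add g.add f.scale g.scale)
qed

lemma T_coset:
  assumes "Vector_Spaces.linear scale (*) f"
  shows "T scale (coset (rel2 scale) (\<Sum>i\<in>I. gen (a i, b i))) f = (\<Sum>i\<in>I. scale (f (a i)) (b i))"
proof -
  interpret f: Vector_Spaces.linear scale "(*)" f by fact
  show ?thesis unfolding T_def
    using f.vs1.lin_ext_rel2[OF f.vs1.subspace_single_0 _ _ _ _ rep_coset[OF subspace_rel2[of scale], of "\<Sum>i\<in>I. gen (a i, b i)"],
        of "\<lambda>(a, b). scale (f a) b"]
    by (simp add: f.vs1.lin_ext_diff f.vs1.lin_ext_sum f.vs1.lin_ext_gen f.add f.scale
        f.vs1.scale_left_distrib f.vs1.scale_right_distrib mult.commute)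
qed

text \<open>Every tensor is a finite sum of pure tensors.\<close>

lemma tensor2_cases:
  assumes "vector_space scale" "r \<in> tensor2 scale"
  obtains n :: nat and a b where "r = coset (rel2 scale) (\<Sum>i<n. gen (a i, b i))"
proof -
  interpret vector_space scale by fact
  obtain p where r: "r = coset (rel2 scale) p" using assms(2) by (auto simp: tensor2_def)
  have p: "p = (\<Sum>x\<in>Poly_Mapping.keys p. free_scale (Poly_Mapping.lookup p x) (gen x))"
    by (rule poly_mapping_eqI)
      (auto simp: Poly_Mapping.lookup_sum Poly_Mapping.lookup_single when_def in_keys_iff
        if_distrib[of "(*) _"] cong: if_cong)
  obtain h and n :: nat where h: "bij_betw h {..<n} (Poly_Mapping.keys p)"
    using ex_bij_betw_nat_finite[OF finite_keys, of p] by (auto simp: atLeast0LessThan)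
  define a where "a i = scale (Poly_Mapping.lookup p (h i)) (fst (h i))" for i
  define b where "b i = snd (h i)" for i
  have "p = (\<Sum>i<n. free_scale (Poly_Mapping.lookup p (h i)) (gen (h i)))"
    by (subst p) (rule sum.reindex_bij_betw[OF h, symmetric])
  then have "(\<Sum>i<n. gen (a i, b i)) - p
      = (\<Sum>i<n. gen (a i, b i) - free_scale (Poly_Mapping.lookup p (h i)) (gen (h i)))"
    by (simp add: sum_subtractf)
  also have "\<dots> \<in> rel2 scale"
    using rel2I(3)[of scale "Poly_Mapping.lookup p (h i)" "fst (h i)" "snd (h i)" for i]
    unfolding a_def b_def by (intro free.subspace_sum[OF subspace_rel2]) simp
  finally show thesis using r that coset_eq_iff[OF subspace_rel2] by metis
qed

lemma (in perm_algebra) perm_YBE_coset: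
  "perm_YBE scale mult (coset (rel2 scale) (\<Sum>i\<in>I. gen (a i, b i))) \<longleftrightarrow>
    coset (rel3 scale) (\<Sum>i\<in>I. \<Sum>j\<in>I.
      gen (a i, mult (b i) (a j), b j) - gen (a i, a j, mult (b i) (b j))
      + gen (mult (a i) (a j), b i, b j) - gen (mult (a j) (a i), b i, b j))
    = coset (rel3 scale) 0"
proof -
  have madd: "mult (x + y) z = mult x z + mult y z" "mult z (x + y) = mult z x + mult z y"
    "mult (scale c x) z = scale c (mult x z)" "mult z (scale c x) = scale c (mult z x)" for x y z c
    using module_hom.add[OF Vector_Spaces.linear.axioms(3)[OF linear_mult_left[of z]]]
      module_hom.add[OF Vector_Spaces.linear.axioms(3)[OF linear_mult_right[of z]]]
      module_hom.scale[OF Vector_Spaces.linear.axioms(3)[OF linear_mult_left[of z]]]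
      module_hom.scale[OF Vector_Spaces.linear.axioms(3)[OF linear_mult_right[of z]]]
    by auto
  note S = free.subspace_add[OF subspace_rel3[of scale]] free.subspace_diff[OF subspace_rel3[of scale]]
    free.subspace_scale[OF subspace_rel3[of scale]]
  define g where "g = (\<lambda>(a, b) (a', b').
      gen (a, mult b a', b') - gen (a, a', mult b b')
      + gen (mult a a', b, b') - gen (mult a' a, b, b') :: ('a \<times> 'a \<times> 'a) \<Rightarrow>\<^sub>0 'k)"
  have four: "(u1 - u2 + u3 - u4) - (v1 - v2 + v3 - v4) - (w1 - w2 + w3 - w4) \<in> rel3 scale"
    if "u1 - v1 - w1 \<in> rel3 scale" "u2 - v2 - w2 \<in> rel3 scale"
      "u3 - v3 - w3 \<in> rel3 scale" "u4 - v4 - w4 \<in> rel3 scale" for u1 u2 u3 u4 v1 v2 v3 v4 w1 w2 w3 w4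
    using S(2)[OF S(1)[OF S(2)[OF that(1,2)] that(3)] that(4)] by (simp add: algebra_simps)
  have four': "(u1 - u2 + u3 - u4) - free_scale c (v1 - v2 + v3 - v4) \<in> rel3 scale"
    if "u1 - free_scale c v1 \<in> rel3 scale" "u2 - free_scale c v2 \<in> rel3 scale"
      "u3 - free_scale c v3 \<in> rel3 scale" "u4 - free_scale c v4 \<in> rel3 scale"
    for u1 u2 u3 u4 v1 v2 v3 v4 c
    using S(2)[OF S(1)[OF S(2)[OF that(1,2)] that(3)] that(4)]
    by (simp add: free.scale_right_distrib free.scale_right_diff_distrib algebra_simps)
  have g2: "lin_ext free_scale (g x) q \<in> rel3 scale" if "q \<in> rel2 scale" for x q
    by (cases x, rule free.lin_ext_rel2[OF subspace_rel3 _ _ _ _ that])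
      (auto simp: g_def madd intro!: four four' rel3I)
  have sw: "lin_ext free_scale (\<lambda>x. lin_ext free_scale (g x) q) p
      = lin_ext free_scale (\<lambda>y. lin_ext free_scale (\<lambda>x. g x y) p) q" for p q
    unfolding lin_ext_def free.scale_sum_right
    by (subst sum.swap) (simp add: mult.commute)
  have g1: "lin_ext free_scale (\<lambda>x. g x y) p \<in> rel3 scale" if "p \<in> rel2 scale" for y p
    by (cases y, rule free.lin_ext_rel2[OF subspace_rel3 _ _ _ _ that])
      (auto simp: g_def madd intro!: four four' rel3I)
  have ybe: "ybe_sum mult p q = lin_ext free_scale (\<lambda>x. lin_ext free_scale (g x) q) p" for p q
    unfolding ybe_sum_def g_def by (simp add: case_prod_unfold)
  define p where "p = (\<Sum>i\<in>I. gen (a i, b i) :: ('a \<times> 'a) \<Rightarrow>\<^sub>0 'k)"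
  define p' where "p' = rep (coset (rel2 scale) p)"
  have d: "p' - p \<in> rel2 scale" unfolding p'_def by (rule rep_coset[OF subspace_rel2])
  have "ybe_sum mult p' p' - ybe_sum mult p' p
      = lin_ext free_scale (\<lambda>x. lin_ext free_scale (g x) (p' - p)) p'"
    unfolding ybe free.lin_ext_diff lin_ext_def[of free_scale _ p']
    by (simp only: free.scale_right_diff_distrib sum_subtractf)
  also have "\<dots> \<in> rel3 scale"
    by (intro free.lin_ext_mem subspace_rel3 g2 d)
  finally have "ybe_sum mult p' p' - ybe_sum mult p' p \<in> rel3 scale" .
  moreover have "ybe_sum mult p' p - ybe_sum mult p p \<in> rel3 scale"
  proof -
    have "lin_ext free_scale (\<lambda>x. lin_ext free_scale (g x) p) (p' - p) \<in> rel3 scale"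
      unfolding sw by (intro free.lin_ext_mem subspace_rel3 g1 d)
    then show ?thesis by (simp only: ybe free.lin_ext_diff)
  qed
  ultimately have "ybe_sum mult p' p' - ybe_sum mult p p \<in> rel3 scale"
    using S(1) by fastforce
  then have "coset (rel3 scale) (ybe_sum mult p' p') = coset (rel3 scale) (ybe_sum mult p p)"
    by (simp add: coset_eq_iff[OF subspace_rel3])
  moreover have "ybe_sum mult p p = (\<Sum>i\<in>I. \<Sum>j\<in>I. g (a i, b i) (a j, b j))"
    unfolding ybe p_def by (simp add: free.lin_ext_sum free.lin_ext_gen)
  ultimately show ?thesis unfolding perm_YBE_def p_def[symmetric] p'_def[symmetric]
    by (simp add: g_def)
qed

end

theory Submission
  imports Defs
begin

text \<open>
  Write \<open>r = (\<Sum>i. a\<^sub>i \<otimes> b\<^sub>i)\<close> and \<open>Q = T\<^bsub>\<sigma>(r)\<^esub> \<circ> B\<^sup>\<sharp>\<close>. Since \<open>B\<close> is nondegenerate, an element of the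
  tensor cube vanishes iff all contractions of its first two factors with \<open>B x\<close> and \<open>B y\<close>
  vanish. Invariance and skew-symmetry give \<open>B y (u v) = B (u y) v\<close> and
  \<open>B x (u v - v u) = B (x u) v\<close>, which turn the contraction of the perm Yang-Baxter sum into
  \<open>P (P x y) - P x P y + P (x Q y)\<close>. The claim follows as \<open>Q = P - T\<^bsub>r - \<sigma>(r)\<^esub> \<circ> B\<^sup>\<sharp>\<close>.
\<close>

text \<open>The generator map of a free space is additive in each tensor slot only modulo the
  relations. This lemma makes it possible to expand one slot into a finite sum.\<close>

lemma additive_mod_subspace_sum:
  assumes N: "free.subspace N" and "finite S"
    and add: "\<And>u v. h (u + v) - h u - h v \<in> N"
  shows "h (\<Sum>x\<in>S. v x) - (\<Sum>x\<in>S. h (v x)) \<in> N"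
  using assms(2)
proof (induction S)
  case empty
  \<comment> \<open>The left side is \<open>- h 0\<close>, so additivity modulo \<open>N\<close>
    forces \<open>h 0\<close> into \<open>N\<close>.\<close>
  have "h (0 + 0) - h 0 - h 0 \<in> N" by (rule add)
  then show ?case using free.subspace_neg[OF N, of "- h 0"] by simp
next
  case (insert x F)
  have "(h (v x + sum v F) - h (v x) - h (sum v F)) + (h (sum v F) - (\<Sum>y\<in>F. h (v y))) \<in> N"
    by (intro free.subspace_add[OF N] add insert.IH)
  then show ?case using insert.hyps by (simp add: algebra_simps)
qed

text \<open>The representative is arbitrary here because that of r - \<sigma>(r) is a difference of
  sums of pure tensors, not such a sum itself.\<close>

lemma (in vector_space) T_coset_lin_ext:
  assumes "Vector_Spaces.linear scale (*) f"
  shows "T scale (coset (rel2 scale) p) f = lin_ext scale (\<lambda>(a, b). scale (f a) b) p"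
proof -
  interpret f: Vector_Spaces.linear scale "(*)" f by fact
  show ?thesis unfolding T_def
    using lin_ext_rel2[OF subspace_single_0 _ _ _ _ rep_coset[OF subspace_rel2[of scale], of p],
        of "\<lambda>(a, b). scale (f a) b"]
    by (simp add: lin_ext_diff f.add f.scale scale_left_distrib scale_right_distrib mult.commute)
qed

section \<open>Identities for the invariant form and a dual basis\<close>

context quadratic_perm_algebra
begin

lemma form_add_right: "B x (a + b) = B x a + B x b"
  and form_scale_right: "B x (scale c a) = c * B x a"
  using module_hom.add[OF Vector_Spaces.linear.axioms(3)[OF linear_form_right[of x]]]
    module_hom.scale[OF Vector_Spaces.linear.axioms(3)[OF linear_form_right[of x]]]
  by auto

lemma form_add_left: "B (a + b) x = B a x + B b x"
  and form_scale_left: "B (scale c a) x = c * B a x"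
  using module_hom.add[OF Vector_Spaces.linear.axioms(3)[OF linear_form_left[of x]]]
    module_hom.scale[OF Vector_Spaces.linear.axioms(3)[OF linear_form_left[of x]]]
  by auto

lemma form_diff_right: "B x (a - b) = B x a - B x b"
  using form_add_right[of x "a - b" b] by simp

lemma form_diff_left: "B (a - b) x = B a x - B b x"
  using form_add_left[of "a - b" b x] by simp

lemma form_sum_right: "B x (\<Sum>i\<in>I. f i) = (\<Sum>i\<in>I. B x (f i))"
  using module_hom.sum[OF Vector_Spaces.linear.axioms(3)[OF linear_form_right[of x]]] .

lemma form_sum_left: "B (\<Sum>i\<in>I. f i) x = (\<Sum>i\<in>I. B (f i) x)"
  using module_hom.sum[OF Vector_Spaces.linear.axioms(3)[OF linear_form_left[of x]]] .

text \<open>Skew-symmetry and invariance give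
  \<open>B y (mult v u) = B (mult u y - mult y u) v\<close>. Adding invariance in the form
  \<open>B (mult y u) v = B y (mult u v - mult v u)\<close> cancels the unwanted terms.\<close>

lemma form_mult_right: "B y (mult u v) = B (mult u y) v"
proof -
  have "B y (mult v u) = - B (mult v u) y"
    by (rule skew_symmetric)
  also have "\<dots> = B (mult u y - mult y u) v"
    using skew_symmetric[of v] by (simp add: invariant)
  finally show ?thesis
    using invariant[of y u v] by (simp add: form_diff_right form_diff_left)
qed

text \<open>Identify functionals with vectors through their values on \<open>Basis\<close>. The map
  \<phi> is then the sharp map of \<open>B\<close>: injective by nondegeneracy, hence surjective by
  finite dimension. Preimages of the basis vectors form the dual basis.\<close>

lemma dual_basis_exists:
  obtains d where "\<And>a. (\<Sum>e\<in>Basis. scale (B (d e) a) e) = a"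
proof -
  define \<phi> where "\<phi> x = (\<Sum>e\<in>Basis. scale (B x e) e)" for x
  have lin: "Vector_Spaces.linear scale scale \<phi>"
    unfolding \<phi>_def
    by unfold_locales (simp_all add: form_add_left form_scale_left scale_left_distrib sum.distrib
        scale_sum_right scale_right_distrib)
  have expand: "(\<Sum>e\<in>Basis. scale (representation Basis a e) e) = a" for a
    by (rule sum_representation_eq[OF independent_Basis]) (auto simp: span_Basis finite_Basis)
  have "x = 0" if "\<phi> x = 0" for x
  proof (rule nondegenerate_left)
    fix b
    have B0: "B x e = 0" if "e \<in> Basis" for e
      using independentD[OF independent_Basis finite_Basis subset_refl, of "B x"] that \<open>\<phi> x = 0\<close>
      by (simp add: \<phi>_def)
    have "B x b = (\<Sum>e\<in>Basis. representation Basis b e * B x e)"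
      by (subst expand[of b, symmetric]) (simp only: form_sum_right form_scale_right)
    then show "B x b = 0" using B0 by simp
  qed
  then have "inj \<phi>"
    using module_hom.inj_iff_eq_0[OF Vector_Spaces.linear.axioms(3)[OF lin]] by blast
  then have surj: "surj \<phi>" by (rule linear_inj_imp_surj[OF lin])
  define d where "d = inv \<phi>"
  have "\<phi> (d e) = e" for e unfolding d_def using surj by (rule surj_f_inv_f)
  \<comment> \<open>Both sides are the coefficient of \<open>f\<close> in the expansion of
    \<open>e = \<phi> (d e)\<close>, so independence of \<open>Basis\<close> equates them.\<close>
  have d: "B (d e) f = (if f = e then 1 else 0)" if "e \<in> Basis" "f \<in> Basis" for e f
  proof -
    have "(\<Sum>f\<in>Basis. scale (B (d e) f - (if f = e then 1 else 0)) f) = \<phi> (d e) - e"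
      using that(1) finite_Basis
      by (simp add: \<phi>_def scale_left_diff_distrib sum_subtractf if_distrib[of "\<lambda>c. scale c _"]
          cong: if_cong)
    then have "(\<Sum>f\<in>Basis. scale (B (d e) f - (if f = e then 1 else 0)) f) = 0"
      using \<open>\<phi> (d e) = e\<close> by simp
    then have "B (d e) f - (if f = e then 1 else 0) = 0"
      by (rule independentD[OF independent_Basis finite_Basis subset_refl _ that(2)])
    then show ?thesis by simp
  qed
  have "B (d e) a = representation Basis a e" if "e \<in> Basis" for a e
  proof -
    have "B (d e) a = (\<Sum>f\<in>Basis. representation Basis a f * B (d e) f)"
      by (subst expand[of a, symmetric]) (simp only: form_sum_right form_scale_right)
    also have "\<dots> = (\<Sum>f\<in>Basis. if f = e then representation Basis a f else 0)"
      by (rule sum.cong) (use d that in auto)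
    finally show ?thesis using that finite_Basis by simp
  qed
  then have "(\<Sum>e\<in>Basis. scale (B (d e) a) e) = a" for a
    using expand[of a] by simp
  then show thesis by (rule that)
qed

section \<open>Contractions detect zero in the tensor cube\<close>

lemmas lin_ext_simps = lin_ext_diff lin_ext_add lin_ext_scale lin_ext_gen lin_ext_sum lin_ext_0

definition contract :: "'a \<Rightarrow> 'a \<Rightarrow> ('a \<times> 'a \<times> 'a \<Rightarrow>\<^sub>0 'k) \<Rightarrow> 'a"
  where "contract x y = lin_ext scale (\<lambda>(a, b, c). scale (B x a * B y b) c)"

text \<open>Contraction is trilinear on generators, so it descends to the tensor cube.\<close>

lemma contract_rel3:
  assumes "p \<in> rel3 scale"
  shows "contract x y p = 0"
  using assms unfolding rel3_def
proof (induction rule: free.span_induct)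
  case base
  show ?case
    by (auto simp: contract_def free.subspace_def lin_ext_simps)
next
  case (step p)
  then show ?case
    by (auto simp: contract_def lin_ext_simps form_add_right form_scale_right
        scale_left_distrib scale_right_distrib distrib_left distrib_right mult_ac)
qed

text \<open>Expanding the first two slots in \<open>Basis\<close> shows that \<open>p\<close> is
  congruent to the sum over basis vectors \<open>e\<close>, \<open>f\<close> of
  \<open>gen (e, f, contract (d e) (d f) p)\<close>. If all contractions vanish, so does every
  summand modulo \<open>rel3 scale\<close>.\<close>

lemma rel3_iff_contract: "p \<in> rel3 scale \<longleftrightarrow> (\<forall>x y. contract x y p = 0)"
proof
  assume R: "\<forall>x y. contract x y p = 0"
  obtain d where d: "\<And>a. (\<Sum>e\<in>Basis. scale (B (d e) a) e) = a"
    using dual_basis_exists by blast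
  note N = subspace_rel3[of scale]
  have trans: "p - q \<in> rel3 scale \<Longrightarrow> q - t \<in> rel3 scale \<Longrightarrow> p - t \<in> rel3 scale" for p q t
    using free.subspace_add[OF N, of "p - q" "q - t"] by simp
  have sum: "(\<Sum>i\<in>I. u i) - (\<Sum>i\<in>I. v i) \<in> rel3 scale"
    if "\<And>i. u i - v i \<in> rel3 scale" for I :: "'i set" and u v
    using that by (simp flip: sum_subtractf add: free.subspace_sum[OF N])
  define g where "g e f = (\<lambda>(a, b, c). scale (B (d e) a * B (d f) b) c)" for e f
  \<comment> \<open>Both dual-basis coefficients move into the third slot, which leaves bare basis
    vectors in the first two.\<close>
  have scale_out: "gen (scale k a, scale l b, c) - gen (a, b, scale (k * l) c) \<in> rel3 scale"
    for k l a b c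
  proof -
    have "(gen (scale k a, scale l b, c) - free_scale k (gen (a, scale l b, c)))
        + free_scale k (gen (a, scale l b, c) - free_scale l (gen (a, b, c)))
        - (gen (a, b, scale (k * l) c) - free_scale (k * l) (gen (a, b, c))) \<in> rel3 scale"
      by (intro free.subspace_diff[OF N] free.subspace_add[OF N] free.subspace_scale[OF N] rel3I)
    then show ?thesis by (simp add: free.scale_right_diff_distrib)
  qed
  have triple: "gen t - (\<Sum>e\<in>Basis. \<Sum>f\<in>Basis. gen (e, f, g e f t)) \<in> rel3 scale" for t
  proof (cases t)
    case (fields a b c)
    have "gen (a, b, c) - (\<Sum>e\<in>Basis. gen (scale (B (d e) a) e, b, c)) \<in> rel3 scale"
      using additive_mod_subspace_sum[OF N finite_Basis, of "\<lambda>a. gen (a, b, c)" "\<lambda>e. scale (B (d e) a) e"]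
      by (simp add: rel3I d)
    moreover have "gen (u, b, c) - (\<Sum>f\<in>Basis. gen (u, scale (B (d f) b) f, c)) \<in> rel3 scale" for u
      using additive_mod_subspace_sum[OF N finite_Basis, of "\<lambda>b. gen (u, b, c)" "\<lambda>f. scale (B (d f) b) f"]
      by (simp add: rel3I d)
    ultimately show ?thesis
      unfolding fields g_def prod.case
      by (blast intro: trans sum scale_out)
  qed
  \<comment> \<open>For fixed \<open>e\<close> and \<open>f\<close>, linearity of the third slot
    collects all terms of \<open>p\<close> into one generator, whose third entry is
    \<open>contract (d e) (d f) p\<close>.\<close>
  have third: "lin_ext free_scale (\<lambda>t. gen (e, f, g e f t)) p
      - gen (e, f, lin_ext scale (g e f) p) \<in> rel3 scale" for e f
  proof -
    let ?v = "\<lambda>t. scale (Poly_Mapping.lookup p t) (g e f t)"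
    have "(gen (e, f, \<Sum>t\<in>Poly_Mapping.keys p. ?v t) - (\<Sum>t\<in>Poly_Mapping.keys p. gen (e, f, ?v t)))
      + ((\<Sum>t\<in>Poly_Mapping.keys p. gen (e, f, ?v t))
         - (\<Sum>t\<in>Poly_Mapping.keys p. free_scale (Poly_Mapping.lookup p t) (gen (e, f, g e f t))))
      \<in> rel3 scale"
      by (intro free.subspace_add[OF N] sum rel3I
          additive_mod_subspace_sum[OF N, of _ "\<lambda>c. gen (e, f, c)"]) simp
    from free.subspace_neg[OF N this] show ?thesis
      by (simp add: lin_ext_def)
  qed
  have p: "lin_ext free_scale gen p = p"
    by (rule poly_mapping_eqI)
      (auto simp: lin_ext_def Poly_Mapping.lookup_sum Poly_Mapping.lookup_single when_def in_keys_iff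
        if_distrib[of "(*) _"] cong: if_cong)
  have "lin_ext scale (g e f) p = 0" for e f
    using R by (simp add: contract_def g_def)
  then have third0: "lin_ext free_scale (\<lambda>t. gen (e, f, g e f t)) p \<in> rel3 scale" for e f
    \<comment> \<open>With both summands zero, the additivity relation reads
      \<open>- gen (e, f, 0)\<close>, so generators with third entry \<open>0\<close> are
      relations.\<close>
    using free.subspace_diff[OF N third[of e f] rel3I(3)[where a = e and b = f and c = 0 and c' = 0]] by simp
  \<comment> \<open>The congruence \<open>triple\<close> for single generators extends linearly to
    \<open>p\<close>.\<close>
  have "lin_ext free_scale (\<lambda>t. gen t - (\<Sum>e\<in>Basis. \<Sum>f\<in>Basis. gen (e, f, g e f t))) p \<in> rel3 scale"
    by (rule free.lin_ext_mem[OF N triple])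
  also have "lin_ext free_scale (\<lambda>t. gen t - (\<Sum>e\<in>Basis. \<Sum>f\<in>Basis. gen (e, f, g e f t))) p
    = p - (\<Sum>e\<in>Basis. \<Sum>f\<in>Basis. lin_ext free_scale (\<lambda>t. gen (e, f, g e f t)) p)"
  proof -
    have "lin_ext free_scale (\<lambda>t. gen t - (\<Sum>e\<in>Basis. \<Sum>f\<in>Basis. gen (e, f, g e f t))) p
      = lin_ext free_scale gen p
        - (\<Sum>t\<in>Poly_Mapping.keys p. \<Sum>e\<in>Basis. \<Sum>f\<in>Basis.
            free_scale (Poly_Mapping.lookup p t) (gen (e, f, g e f t)))"
      by (simp add: lin_ext_def free.scale_right_diff_distrib sum_subtractf free.scale_sum_right)
    also have "(\<Sum>t\<in>Poly_Mapping.keys p. \<Sum>e\<in>Basis. \<Sum>f\<in>Basis.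
            free_scale (Poly_Mapping.lookup p t) (gen (e, f, g e f t)))
        = (\<Sum>e\<in>Basis. \<Sum>t\<in>Poly_Mapping.keys p. \<Sum>f\<in>Basis.
            free_scale (Poly_Mapping.lookup p t) (gen (e, f, g e f t)))"
      by (rule sum.swap)
    also have "\<dots> = (\<Sum>e\<in>Basis. \<Sum>f\<in>Basis. lin_ext free_scale (\<lambda>t. gen (e, f, g e f t)) p)"
      unfolding lin_ext_def by (intro sum.cong refl sum.swap)
    finally show ?thesis by (simp only: p)
  qed
  finally have "p - (\<Sum>e\<in>Basis. \<Sum>f\<in>Basis. lin_ext free_scale (\<lambda>t. gen (e, f, g e f t)) p)
    \<in> rel3 scale" .
  moreover have "(\<Sum>e\<in>Basis. \<Sum>f\<in>Basis. lin_ext free_scale (\<lambda>t. gen (e, f, g e f t)) p) \<in> rel3 scale"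
    by (intro free.subspace_sum[OF N] third0)
  ultimately show "p \<in> rel3 scale"
    using free.subspace_add[OF N] by fastforce
qed (auto dest: contract_rel3)

section \<open>Contraction of the perm Yang-Baxter sum\<close>

lemma mult_scale: "mult (scale c x) z = scale c (mult x z)" "mult z (scale c x) = scale c (mult z x)"
  using module_hom.scale[OF Vector_Spaces.linear.axioms(3)[OF linear_mult_left[of z]]]
    module_hom.scale[OF Vector_Spaces.linear.axioms(3)[OF linear_mult_right[of z]]]
  by auto

lemma mult_diff_right: "mult z (x - y) = mult z x - mult z y"
  using module_hom.diff[OF Vector_Spaces.linear.axioms(3)[OF linear_mult_right]] .

lemma mult_sum: "mult (\<Sum>i\<in>I. f i) z = (\<Sum>i\<in>I. mult (f i) z)" "mult z (\<Sum>i\<in>I. f i) = (\<Sum>i\<in>I. mult z (f i))"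
  using module_hom.sum[OF Vector_Spaces.linear.axioms(3)[OF linear_mult_left[of z]]]
    module_hom.sum[OF Vector_Spaces.linear.axioms(3)[OF linear_mult_right[of z]]]
  by auto

text \<open>Contracting the four terms of the Yang-Baxter sum with \<open>B x\<close> and
  \<open>B y\<close> yields \<open>P (mult (P x) y)\<close> from the first,
  \<open>- mult (P x) (P y)\<close> from the second and \<open>P (mult x (Q y))\<close> from the
  last two together.\<close>

lemma perm_YBE_iff_operators:
  fixes a b :: "'i \<Rightarrow> 'a" and I :: "'i set"
  defines "P \<equiv> \<lambda>x. \<Sum>i\<in>I. scale (B x (a i)) (b i)"
    and "Q \<equiv> \<lambda>x. \<Sum>i\<in>I. scale (B x (b i)) (a i)"
  shows "perm_YBE scale mult (coset (rel2 scale) (\<Sum>i\<in>I. gen (a i, b i))) \<longleftrightarrow>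
    (\<forall>x y. mult (P x) (P y) = P (mult (P x) y + mult x (Q y)))"
proof -
  define E where "E = (\<Sum>i\<in>I. \<Sum>j\<in>I.
      gen (a i, mult (b i) (a j), b j) - gen (a i, a j, mult (b i) (b j))
      + gen (mult (a i) (a j), b i, b j) - gen (mult (a j) (a i), b i, b j) :: 'a \<times> 'a \<times> 'a \<Rightarrow>\<^sub>0 'k)"
  have P_add: "P (u + v) = P u + P v" for u v
    by (simp add: P_def form_add_left scale_left_distrib sum.distrib)
  have "contract x y E = P (mult (P x) y + mult x (Q y)) - mult (P x) (P y)" for x y
  proof -
    have comm: "B x (mult u v) - B x (mult v u) = B (mult x u) v" for u v
      by (simp add: invariant form_diff_right)
    have 1: "P (mult (P x) y)
        = (\<Sum>j\<in>I. \<Sum>i\<in>I. scale (B x (a i) * B y (mult (b i) (a j))) (b j))"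
      unfolding P_def mult_sum form_sum_left mult_scale form_scale_left form_mult_right scale_sum_left ..
    have 2: "mult (P x) (P y)
        = (\<Sum>j\<in>I. \<Sum>i\<in>I. scale (B x (a i) * B y (a j)) (mult (b i) (b j)))"
      unfolding P_def mult_sum mult_scale by (simp add: scale_sum_right mult.commute)
    have 3: "P (mult x (Q y)) = (\<Sum>j\<in>I. \<Sum>i\<in>I.
        scale (B x (mult (a i) (a j)) * B y (b i)) (b j) - scale (B x (mult (a j) (a i)) * B y (b i)) (b j))"
      unfolding P_def Q_def mult_sum mult_scale form_sum_left form_scale_left scale_sum_left
      by (simp add: comm[symmetric] algebra_simps)
    have "contract x y E = (\<Sum>i\<in>I. \<Sum>j\<in>I.
        scale (B x (a i) * B y (mult (b i) (a j))) (b j) - scale (B x (a i) * B y (a j)) (mult (b i) (b j))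
        + (scale (B x (mult (a i) (a j)) * B y (b i)) (b j)
           - scale (B x (mult (a j) (a i)) * B y (b i)) (b j)))"
      by (simp add: E_def contract_def lin_ext_simps add_diff_eq)
    also have "\<dots> = P (mult (P x) y) - mult (P x) (P y) + P (mult x (Q y))"
      unfolding 1 2 3 sum.distrib sum_subtractf
      \<comment> \<open>The contracted sum runs over \<open>i\<close> outside and \<open>j\<close>
        inside, the expansions \<open>1\<close>, \<open>2\<close> and \<open>3\<close> the other way
        round.\<close>
      by (subst (1 3 4 5) sum.swap) (rule refl)
    finally show ?thesis by (simp add: P_add)
  qed
  then show ?thesis
    unfolding perm_YBE_coset E_def[symmetric] coset_eq_iff[OF subspace_rel3]
    by (auto simp: rel3_iff_contract)
qed

end

theorem proposition4p13:
  fixes scale :: "'k::field_char_0 \<Rightarrow> 'a::ab_group_add \<Rightarrow> 'a"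
    and Basis :: "'a set"
    and mult :: "'a \<Rightarrow> 'a \<Rightarrow> 'a"
    and B :: "'a \<Rightarrow> 'a \<Rightarrow> 'k"
    and r :: "(('a \<times> 'a) \<Rightarrow>\<^sub>0 'k) set"
    and P :: "'a \<Rightarrow> 'a"
  assumes "quadratic_perm_algebra scale Basis mult B"
    and "r \<in> tensor2 scale"
    and "R_ad_invariant scale mult (skew_part scale r)"
    and "\<And>a. P a = T scale r (sharp B a)"
  shows "perm_YBE scale mult r \<longleftrightarrow>
    (\<forall>a b. mult (P a) (P b) =
      P (mult (P a) b + mult a (P b)
         - mult a (T scale (tdiff scale r (tflip scale r)) (sharp B b))))"
proof -
  interpret quadratic_perm_algebra scale Basis mult B by fact
  obtain n :: nat and a b where r: "r = coset (rel2 scale) (\<Sum>i<n. gen (a i, b i))"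
    using tensor2_cases[OF vector_space_axioms assms(2)] by blast
  have lin: "Vector_Spaces.linear scale (*) (sharp B x)" for x
    unfolding sharp_def by (rule linear_form_right)
  have P: "P x = (\<Sum>i<n. scale (B x (a i)) (b i))" for x
    unfolding assms(4) r T_coset[OF lin] by (simp add: sharp_def)
  define Q where "Q x = (\<Sum>i<n. scale (B x (b i)) (a i))" for x
  have D: "T scale (tdiff scale r (tflip scale r)) (sharp B y) = P y - Q y" for y
    unfolding r tflip_coset tdiff_coset T_coset_lin_ext[OF lin]
    by (simp add: lin_ext_simps P Q_def sharp_def)
  have "perm_YBE scale mult r \<longleftrightarrow>
      (\<forall>x y. mult (P x) (P y) = P (mult (P x) y + mult x (Q y)))"
    unfolding r P Q_def by (rule perm_YBE_iff_operators)
  \<comment> \<open>By \<open>D\<close>, the terms \<open>mult a (P b)\<close> cancel in the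
    argument of \<open>P\<close>, which leaves \<open>mult (P a) b + mult a (Q b)\<close>.\<close>
  then show ?thesis by (simp add: D mult_diff_right)
qed

end
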